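(* Let $H:\mathbb N\to\mathbb N$ be defined by $H(0)=0$ and $H(i)=i-H(H(H(i-1)))$ for $i\ge1$, and let $S=S(0)S(1)S(2)\cdots$ be the infinite word where $S(i)$ is the number of $k\ge0$ with $H(k)=i$. Then for every $n\ge1$, the number of distinct factors of length $n$ of $S$ is $2n$. *)

theory Defs
  imports Main "HOL-Library.Omega_Words_Fun"
begin

function hofstadter_H :: "nat \<Rightarrow> nat" where
  "hofstadter_H 0 = 0"
| "hofstadter_H (Suc i) = Suc i - hofstadter_H (hofstadter_H (hofstadter_H i))"
  by pat_completeness auto

lemma hofstadter_H_dom_le:
  "hofstadter_H_dom i \<Longrightarrow> hofstadter_H i \<le> i"
  by (induction i rule: hofstadter_H.pinduct) (simp_all add: hofstadter_H.psimps)

termination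
proof (relation "measure id", simp, simp)
  fix i assume "hofstadter_H_dom i"
  then show "(hofstadter_H i, Suc i) \<in> measure id"
    using hofstadter_H_dom_le[of i] by simp
next
  fix i assume "hofstadter_H_dom i" "hofstadter_H_dom (hofstadter_H i)"
  then show "(hofstadter_H (hofstadter_H i), Suc i) \<in> measure id"
    using hofstadter_H_dom_le[of i] hofstadter_H_dom_le[of "hofstadter_H i"] by simp
qed

lemma hofstadter_H_le: "hofstadter_H i \<le> i"
  by (cases i) simp_all

lemma hofstadter_H3_le: "hofstadter_H (hofstadter_H (hofstadter_H i)) \<le> i"
  by (meson hofstadter_H_le le_trans)

text \<open>The subtraction in the recursion is never truncated.\<close>

lemma hofstadter_H_rec:
  assumes "i \<ge> 1"
  shows "int (hofstadter_H i) =
    int i - int (hofstadter_H (hofstadter_H (hofstadter_H (i - 1))))"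
proof -
  obtain j where j: "i = Suc j" using assms by (cases i) auto
  show ?thesis using hofstadter_H3_le[of j] by (simp add: j of_nat_diff)
qed

definition H_word :: "nat word" where
  "H_word i = card {k. hofstadter_H k = i}"

text \<open>Every fibre of \<open>hofstadter_H\<close> is finite, so that \<open>card\<close> above is a genuine count.\<close>

lemma hofstadter_H_step:
  "hofstadter_H (Suc i) = hofstadter_H i \<or> hofstadter_H (Suc i) = Suc (hofstadter_H i)"
proof (induction i rule: less_induct)
  case (less i)
  show ?case
  proof (cases i)
    case 0
    then show ?thesis by simp
  next
    case (Suc j)
    let ?H = hofstadter_H
    have j: "j < i" "?H j < i" "?H (?H j) < i"
      using Suc hofstadter_H_le[of j] hofstadter_H_le[of "?H j"] by auto
    have "?H (?H (?H (Suc j))) = ?H (?H (?H j)) \<or>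
        ?H (?H (?H (Suc j))) = Suc (?H (?H (?H j)))"
      using less.IH[OF j(1)] less.IH[OF j(2)] less.IH[OF j(3)] by metis
    then show ?thesis
      using hofstadter_H3_le[of j] by (auto simp: Suc simp del: hofstadter_H.simps(2)
          simp: hofstadter_H.simps(2)[of j] hofstadter_H.simps(2)[of "Suc j"])
  qed
qed

lemma hofstadter_H_mono: "mono hofstadter_H"
  unfolding mono_iff_le_Suc using hofstadter_H_step by (metis le_SucI order_refl)

lemma finite_hofstadter_H_fibre: "finite {k. hofstadter_H k = i}"
proof (rule finite_subset)
  show "{k. hofstadter_H k = i} \<subseteq> {..2 * i}"
  proof (rule subsetI, rule ccontr)
    fix k assume k: "k \<in> {k. hofstadter_H k = i}" "k \<notin> {..2 * i}"
    have 1: "hofstadter_H (Suc (2 * i)) \<le> i" "hofstadter_H (2 * i) \<le> i"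
      using k monoD[OF hofstadter_H_mono, of "Suc (2 * i)" k]
        monoD[OF hofstadter_H_mono, of "2 * i" k] by auto
    have "hofstadter_H (hofstadter_H (hofstadter_H (2 * i))) \<le> i"
      using 1(2) by (meson hofstadter_H_le le_trans)
    then show False using 1(1) by simp
  qed
qed simp

definition factors :: "nat \<Rightarrow> 'a word \<Rightarrow> 'a list set" where
  "factors n w = {w [i \<rightarrow> i + n] | i. True}"

end

theory Submission
  imports Defs
begin

text \<open>
  Mark each \<open>k\<close> by the letter \<open>x k \<in> {1, 2, 3}\<close> saying whether \<open>H\<close> fails to increase from \<open>k\<close> to
  \<open>k + 1\<close>, only \<open>H\<close> increases, or \<open>H \<circ> H\<close> increases too.  The recursion makes \<open>x\<close> the fixed point
  of the substitution \<open>3 \<mapsto> 31, 1 \<mapsto> 2, 2 \<mapsto> 3\<close>, and \<open>S\<close> is the letter \<open>1\<close> followed by the image of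
  \<open>x\<close> under \<open>3 \<mapsto> 2; 1, 2 \<mapsto> 1\<close>.  Desubstitution shows that the factors of \<open>x\<close> with several left
  extensions are exactly its prefixes, and that all three letters precede each of them.  Hence the
  factors of \<open>S\<close> of length \<open>n \<ge> 1\<close> with two left extensions are exactly the prefixes of \<open>S\<close> and of
  \<open>S\<close> without its first letter, and the number of factors grows by two with every step of \<open>n\<close>.
\<close>

abbreviation H :: "nat \<Rightarrow> nat" where "H \<equiv> hofstadter_H"

definition jump_letter :: "nat \<Rightarrow> nat" where
  "jump_letter k = (if H (Suc k) = H k then 1 else if H (H (Suc k)) = H (H k) then 2 else 3)"

text \<open>The position where the image of the \<open>m\<close>-th letter under the substitution starts.\<close>

fun subst_pos :: "nat \<Rightarrow> nat" where
  "subst_pos 0 = 0"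
| "subst_pos (Suc m) = subst_pos m + (if jump_letter m = 3 then 2 else 1)"

section \<open>The substitution\<close>

declare hofstadter_H.simps(2) [simp del]

lemma jump_letter_cases: "jump_letter k = 1 \<or> jump_letter k = 2 \<or> jump_letter k = 3"
  by (simp add: jump_letter_def)

text \<open>The recursion says that \<open>H (Suc k)\<close> and \<open>H (H (H k))\<close> add up
  to \<open>Suc k\<close>. Passing from \<open>k\<close> to \<open>Suc k\<close> raises this sum by
  one, so exactly one of the two terms increases.\<close>

lemma H_no_jump_iff: "H (Suc (Suc k)) = H (Suc k) \<longleftrightarrow> H (H (H (Suc k))) \<noteq> H (H (H k))"
proof -
  have "H (H (H (Suc k))) = H (H (H k)) \<or> H (H (H (Suc k))) = Suc (H (H (H k)))"
    using hofstadter_H_step by metis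
  moreover have "H (Suc k) + H (H (H k)) = Suc k"
    using hofstadter_H3_le[of k] by (simp add: hofstadter_H.simps(2))
  moreover have "H (Suc (Suc k)) + H (H (H (Suc k))) = Suc (Suc k)"
    using hofstadter_H3_le[of "Suc k"] hofstadter_H.simps(2)[of "Suc k"] by linarith
  ultimately show ?thesis by linarith
qed

text \<open>Thus \<open>subst_pos m\<close> is the last argument with value \<open>m\<close>. By
  \<open>H_no_jump_iff\<close> the value \<open>Suc m\<close> is taken a second time exactly if
  \<open>jump_letter m = 3\<close>, and never a third time.\<close>

lemma H_subst_pos: "H (subst_pos m) = m \<and> H (Suc (subst_pos m)) = Suc m"
proof (induction m)
  case 0
  show ?case by (simp add: hofstadter_H.simps(2))
next
  case (Suc m)
  let ?k = "subst_pos m"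
  have k: "H ?k = m" "H (Suc ?k) = Suc m" using Suc by auto
  show ?case
  proof (cases "jump_letter m = 3")
    case True
    then have "H (H (Suc m)) \<noteq> H (H m)" by (auto simp: jump_letter_def split: if_splits)
    then have 1: "H (Suc (Suc ?k)) = Suc m"
      using H_no_jump_iff[of ?k] unfolding k by simp
    then have "H (Suc (Suc (Suc ?k))) \<noteq> Suc m"
      using H_no_jump_iff[of "Suc ?k"] unfolding k 1 by simp
    then have "H (Suc (Suc (Suc ?k))) = Suc (Suc m)"
      using hofstadter_H_step[of "Suc (Suc ?k)"] unfolding 1 by simp
    with 1 True show ?thesis by simp
  next
    case False
    then have "H (H (Suc m)) = H (H m)" by (auto simp: jump_letter_def split: if_splits)
    then have "H (Suc (Suc ?k)) \<noteq> Suc m"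
      using H_no_jump_iff[of ?k] unfolding k by simp
    then have "H (Suc (Suc ?k)) = Suc (Suc m)"
      using hofstadter_H_step[of "Suc ?k"] unfolding k by simp
    with k False show ?thesis by simp
  qed
qed

lemmas H_subst_pos1 = H_subst_pos[THEN conjunct1] and H_subst_pos2 = H_subst_pos[THEN conjunct2]

lemma le_subst_pos_iff: "k \<le> subst_pos m \<longleftrightarrow> H k \<le> m"
  using monoD[OF hofstadter_H_mono, of k "subst_pos m"]
    monoD[OF hofstadter_H_mono, of "Suc (subst_pos m)" k] H_subst_pos1[of m] H_subst_pos2[of m]
  by (metis not_less_eq_eq)

text \<open>\<open>H\<close> passes from \<open>m\<close> to \<open>Suc m\<close> here, so
  \<open>H (H _)\<close> increases exactly if \<open>H\<close> does so at \<open>m\<close>. Together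
  with \<open>jump_letter_Suc_subst_pos\<close> this is the fixed point property.\<close>

lemma jump_letter_subst_pos: "jump_letter (subst_pos m) = (if jump_letter m = 1 then 2 else 3)"
  unfolding jump_letter_def by (simp add: H_subst_pos1 H_subst_pos2)

lemma jump_letter_Suc_subst_pos:
  assumes "jump_letter m = 3"
  shows "jump_letter (Suc (subst_pos m)) = 1"
proof -
  have "H (Suc (Suc (subst_pos m))) = Suc m"
    using H_subst_pos1[of "Suc m"] assms by simp
  then show ?thesis by (simp add: jump_letter_def H_subst_pos2)
qed

text \<open>A letter other than \<open>1\<close> marks the end of a fibre of \<open>H\<close>. Hence
  the images of letters start exactly where such letters stand.\<close>

lemma subst_pos_surj:
  assumes "jump_letter k \<noteq> 1"
  obtains m where "k = subst_pos m"
proof -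
  have "H (Suc k) = Suc (H k)"
    using assms hofstadter_H_step[of k] by (auto simp: jump_letter_def split: if_splits)
  then have "\<not> Suc k \<le> subst_pos (H k)" by (simp add: le_subst_pos_iff)
  moreover have "k \<le> subst_pos (H k)" by (simp add: le_subst_pos_iff)
  ultimately show ?thesis using that[of "H k"] by simp
qed

lemma jump_letter_0: "jump_letter 0 = 3"
  by (simp add: jump_letter_def hofstadter_H.simps(2))

section \<open>Forced predecessors of letters\<close>

lemma pred_of_1:
  assumes "jump_letter (Suc k) = 1"
  shows "jump_letter k = 3"
proof -
  have "H (Suc (Suc k)) = H (Suc k)"
    using assms by (auto simp: jump_letter_def split: if_splits)
  then have "H (H (H (Suc k))) \<noteq> H (H (H k))" using H_no_jump_iff by blast
  then show ?thesis by (auto simp: jump_letter_def)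
qed

text \<open>A \<open>2\<close> is the image of a \<open>1\<close>; the letter before that
  \<open>1\<close> is \<open>3\<close>, whose image ends in \<open>1\<close>.\<close>

lemma pred_of_2:
  assumes "jump_letter (Suc k) = 2"
  shows "jump_letter k = 1"
proof -
  obtain m where m: "Suc k = subst_pos m" using subst_pos_surj[of "Suc k"] assms by auto
  have m1: "jump_letter m = 1"
    using assms jump_letter_subst_pos[of m] by (auto simp: m split: if_splits)
  then obtain l where l: "m = Suc l" using jump_letter_0 by (cases m) auto
  have "jump_letter l = 3" using m1 pred_of_1 by (simp add: l)
  then show ?thesis using m jump_letter_Suc_subst_pos[of l] by (simp add: l)
qed

lemma succ_of_2: "jump_letter k = 2 \<Longrightarrow> jump_letter (Suc k) = 3"
  using pred_of_1[of k] pred_of_2[of k] jump_letter_cases[of "Suc k"] by auto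

section \<open>Values of the Hofstadter word\<close>

lemma H_word_0: "H_word 0 = 1"
proof -
  have "{k. H k = 0} = {0}"
    using le_subst_pos_iff[of _ 0] by (auto)
  then show ?thesis by (simp add: H_word_def)
qed

lemma H_word_Suc: "H_word (Suc m) = (if jump_letter m = 3 then 2 else 1)"
proof -
  have "H k = Suc m \<longleftrightarrow> subst_pos m < k \<and> k \<le> subst_pos (Suc m)" for k
    using le_subst_pos_iff[of k m] le_subst_pos_iff[of k "Suc m"] by linarith
  then have "{k. H k = Suc m} = {subst_pos m<..subst_pos (Suc m)}"
    unfolding greaterThanAtMost_def greaterThan_def atMost_def by blast
  then show ?thesis by (simp add: H_word_def)
qed

section \<open>Left special factors of the fixed point\<close>

text \<open>The last letter of an image determines the letter it comes from, so distinct left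
  extensions stay distinct under substitution and desubstitution.\<close>

lemma jump_letter_before_subst_pos:
  "jump_letter (subst_pos (Suc m) - 1) =
     (if jump_letter m = 3 then 1 else if jump_letter m = 1 then 2 else 3)"
  using jump_letter_Suc_subst_pos[of m] jump_letter_subst_pos[of m] by simp

lemma subst_pos_shift:
  assumes "\<forall>k<m. jump_letter (a + k) = jump_letter k"
  shows "subst_pos (a + m) = subst_pos a + subst_pos m"
  using assms by (induction m) auto

text \<open>The initial \<open>3\<close> has an image of length two, so a nonempty prefix has a
  strictly longer image. This gain drives the inductions on length below.\<close>

lemma Suc_le_subst_pos: "m \<ge> 1 \<Longrightarrow> Suc m \<le> subst_pos m"
  by (induction m rule: dec_induct) (auto simp: jump_letter_0)

lemma strict_mono_subst_pos: "strict_mono subst_pos"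
  by (simp add: strict_mono_Suc_iff)

lemma jump_letter_shift_subst_pos:
  assumes "\<forall>k<m. jump_letter (a + k) = jump_letter k" and k: "k < subst_pos m"
  shows "jump_letter (subst_pos a + k) = jump_letter k"
proof (cases "jump_letter k = 1")
  case False
  then obtain l where l: "k = subst_pos l" using subst_pos_surj by blast
  then have "l < m" using k strict_mono_subst_pos by (simp add: strict_mono_less)
  then show ?thesis
    using assms(1) subst_pos_shift[of l a] jump_letter_subst_pos[of "a + l"]
      jump_letter_subst_pos[of l] by (simp add: l)
next
  case True
  then obtain k' where k': "k = Suc k'" using jump_letter_0 by (cases k) auto
  then have 3: "jump_letter k' = 3" using True pred_of_1 by simp
  then obtain l where l: "k' = subst_pos l" using subst_pos_surj[of k'] by auto
  then have "l < m" using k strict_mono_subst_pos strict_mono_less[of subst_pos l m] by (simp add: k')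
  \<comment> \<open>Otherwise the image of letter \<open>l\<close> has length one and
    \<open>k\<close> starts the next image, but no image starts with \<open>1\<close>.\<close>
  have "jump_letter l = 3"
  proof (rule ccontr)
    assume "jump_letter l \<noteq> 3"
    then have "k = subst_pos (Suc l)" by (simp add: k' l)
    then show False using True jump_letter_subst_pos[of "Suc l"] by (simp split: if_splits)
  qed
  then have "jump_letter (Suc (subst_pos (a + l))) = 1"
    using assms(1) \<open>l < m\<close> by (simp add: jump_letter_Suc_subst_pos)
  then show ?thesis
    using assms(1) \<open>l < m\<close> True subst_pos_shift[of l a] by (simp add: k' l)
qed

text \<open>Since \<open>1\<close> and \<open>2\<close> have forced predecessors, a nonempty left
  special factor starts with \<open>3\<close>, hence at the start of an image. Its preimage is a
  shorter left special factor, so a prefix by induction, and images of prefixes are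
  prefixes.\<close>

lemma left_special_imp_prefix:
  assumes "jump_letter i \<noteq> jump_letter j"
    and "\<forall>k<n. jump_letter (Suc i + k) = jump_letter (Suc j + k)"
  shows "\<forall>k<n. jump_letter (Suc i + k) = jump_letter k"
  using assms
proof (induction n arbitrary: i j rule: less_induct)
  case (less n)
  note agree = less.prems(2)
  show ?case
  proof (cases "n = 0")
    case False
    then have eq: "jump_letter (Suc i) = jump_letter (Suc j)" using agree by force
    then have i3: "jump_letter (Suc i) = 3"
      using pred_of_1[of i] pred_of_1[of j] pred_of_2[of i] pred_of_2[of j]
        jump_letter_cases[of "Suc i"] less.prems(1) by auto
    obtain a where "Suc i = subst_pos a" using subst_pos_surj[of "Suc i"] i3 by auto
    then obtain a where a: "Suc i = subst_pos (Suc a)" by (cases a) auto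
    obtain b where "Suc j = subst_pos b" using subst_pos_surj[of "Suc j"] i3 eq by auto
    then obtain b where b: "Suc j = subst_pos (Suc b)" by (cases b) auto
    have ab: "jump_letter a \<noteq> jump_letter b"
      using jump_letter_before_subst_pos[of a] jump_letter_before_subst_pos[of b] less.prems(1)
      by (metis a b diff_Suc_1)
    show ?thesis
    proof (cases "\<forall>k<n - 1. jump_letter (Suc a + k) = jump_letter (Suc b + k)")
      case True
      then have IH: "\<forall>k<n - 1. jump_letter (Suc a + k) = jump_letter k"
        using less.IH[of "n - 1" a b] ab False by simp
      show ?thesis
      proof (cases "n = 1")
        case True
        then show ?thesis using i3 jump_letter_0 by simp
      next
        case False
        then have "n \<le> subst_pos (n - 1)" using Suc_le_subst_pos[of "n - 1"] \<open>n \<noteq> 0\<close> by simp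
        then show ?thesis unfolding a using jump_letter_shift_subst_pos[OF IH] by simp
      qed
    next
      case False
      define m where "m = (LEAST m. jump_letter (Suc a + m) \<noteq> jump_letter (Suc b + m))"
      have m: "jump_letter (Suc a + m) \<noteq> jump_letter (Suc b + m)"
        unfolding m_def by (rule LeastI_ex) (use False in blast)
      have below: "\<forall>k<m. jump_letter (Suc a + k) = jump_letter (Suc b + k)"
        unfolding m_def using not_less_Least by blast
      have "m < n" using False below by (meson diff_le_self less_le_trans not_le order.strict_trans2)
      then have IHa: "\<forall>k<m. jump_letter (Suc a + k) = jump_letter k"
        using less.IH[of m a b] ab below by simp
      then have IHb: "\<forall>k<m. jump_letter (Suc b + k) = jump_letter k"
        using below by simp
      note shift_a = subst_pos_shift[OF IHa] and shift_b = subst_pos_shift[OF IHb]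
      have pre: "jump_letter (Suc i + k) = jump_letter k" if "k < subst_pos m" for k
        unfolding a using jump_letter_shift_subst_pos[OF IHa that] .
      show ?thesis
      proof (cases "subst_pos m < n")
        case False
        then show ?thesis using pre by simp
      next
        case True
        \<comment> \<open>The first differing letters have images starting alike, so they are \<open>2\<close> and \<open>3\<close>. As \<open>2\<close> only
          follows \<open>1\<close>, the prefix of length \<open>m\<close> (if nonempty) ends in \<open>1\<close>, which \<open>1\<close> never follows.\<close>
        have "jump_letter (subst_pos (Suc a + m)) = jump_letter (subst_pos (Suc b + m))"
          unfolding shift_a shift_b using agree True unfolding a b by blast
        then have iff1: "jump_letter (Suc a + m) = 1 \<longleftrightarrow> jump_letter (Suc b + m) = 1"
          unfolding jump_letter_subst_pos by (simp split: if_splits)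
        have nxt: "jump_letter (Suc (subst_pos c)) = 1 \<longleftrightarrow> jump_letter c = 3" for c
          using jump_letter_Suc_subst_pos[of c] jump_letter_subst_pos[of "Suc c"]
          by (auto split: if_splits)
        \<comment> \<open>By \<open>nxt\<close> the letter after the start of an image tells
          \<open>3\<close> from \<open>2\<close>, so the agreement ends at most one letter past the
          image of the common prefix.\<close>
        have "\<not> Suc (subst_pos m) < n"
        proof
          assume "Suc (subst_pos m) < n"
          then have "jump_letter (Suc (subst_pos (Suc a + m))) = jump_letter (Suc (subst_pos (Suc b + m)))"
            unfolding shift_a shift_b using agree unfolding a b by (metis add_Suc_right)
          then have "jump_letter (Suc a + m) = 3 \<longleftrightarrow> jump_letter (Suc b + m) = 3"
            using nxt by metis
          then show False
            using m iff1 jump_letter_cases[of "Suc a + m"] jump_letter_cases[of "Suc b + m"] by metis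
        qed
        moreover have "jump_letter m \<noteq> 1"
        proof (cases m)
          case 0
          then show ?thesis using jump_letter_0 by simp
        next
          case (Suc l)
          have "jump_letter (Suc a + m) = 2 \<or> jump_letter (Suc b + m) = 2"
            using m iff1 jump_letter_cases[of "Suc a + m"] jump_letter_cases[of "Suc b + m"] by metis
          then have "jump_letter l = 1"
            using pred_of_2[of "Suc a + l"] pred_of_2[of "Suc b + l"] IHa IHb by (auto simp: Suc)
          then show ?thesis using pred_of_1[of l] by (auto simp: Suc)
        qed
        moreover have "jump_letter (Suc a + m) \<noteq> 1" using iff1 m by metis
        ultimately have "jump_letter (Suc i + subst_pos m) = jump_letter (subst_pos m)"
          unfolding a shift_a[symmetric] jump_letter_subst_pos by simp
        then show ?thesis
          using pre \<open>\<not> Suc (subst_pos m) < n\<close> by (metis less_antisym linorder_neqE_nat less_trans_Suc)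
      qed
    qed
  qed simp
qed

lemma jump_letter_initial:
  "jump_letter 1 = 1" "jump_letter 2 = 2" "jump_letter 3 = 3" "jump_letter 4 = 3"
  "jump_letter 5 = 1" "jump_letter 6 = 3"
proof -
  have "H 1 = 1" "H 2 = 1" using hofstadter_H.simps(2)[of 0] hofstadter_H.simps(2)[of 1]
    by (simp_all add: numeral_2_eq_2)
  then have H: "H 1 = 1" "H 2 = 1" "H 3 = 2" "H 4 = 3" "H 5 = 4" "H 6 = 4" "H 7 = 5"
    using hofstadter_H.simps(2)[of 2] hofstadter_H.simps(2)[of 3] hofstadter_H.simps(2)[of 4]
      hofstadter_H.simps(2)[of 5] hofstadter_H.simps(2)[of 6] by simp_all
  then show "jump_letter 1 = 1" "jump_letter 2 = 2" "jump_letter 3 = 3" "jump_letter 4 = 3"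
    "jump_letter 5 = 1" "jump_letter 6 = 3"
    by (simp_all add: jump_letter_def numeral_2_eq_2[symmetric] del: One_nat_def)
qed

lemma prefix_left_extensions:
  assumes "c \<in> {1, 2, 3}"
  shows "\<exists>i. jump_letter i = c \<and> (\<forall>k<n. jump_letter (Suc i + k) = jump_letter k)"
  using assms
proof (induction n arbitrary: c)
  case 0
  show ?case using 0 jump_letter_initial by auto
next
  case (Suc n)
  \<comment> \<open>\<open>d\<close> is the letter whose image ends in \<open>c\<close>.\<close>
  define d :: nat where "d = (if c = 1 then 3 else if c = 2 then 1 else 2)"
  obtain i where i: "jump_letter i = d" "\<forall>k<n. jump_letter (Suc i + k) = jump_letter k"
    using Suc.IH[of d] by (force simp: d_def)
  let ?i = "subst_pos (Suc i) - 1"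
  have c: "jump_letter ?i = c"
    unfolding jump_letter_before_subst_pos i(1) using Suc.prems by (auto simp: d_def)
  have S: "Suc ?i = subst_pos (Suc i)" by simp
  show ?case
  proof (cases "n = 0")
    case False
    then have "Suc n \<le> subst_pos n" using Suc_le_subst_pos by simp
    then have "\<forall>k<Suc n. jump_letter (Suc ?i + k) = jump_letter k"
      unfolding S using jump_letter_shift_subst_pos[OF i(2)] by simp
    then show ?thesis using c by blast
  next
    case True
    \<comment> \<open>The empty prefix gains no length. Instead, positions 5, 2 and 3 carry
      \<open>1\<close>, \<open>2\<close> and \<open>3\<close>, each followed by a
      \<open>3\<close>.\<close>
    show ?thesis
      using True Suc.prems jump_letter_0 jump_letter_initial by auto
  qed
qed

section \<open>Left special factors of the Hofstadter word\<close>

text \<open>\<open>H_word\<close> only tells \<open>3\<close> from the other letters, but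
  \<open>1\<close> follows only \<open>3\<close> and \<open>2\<close> follows only \<open>1\<close>,
  so the previous letter resolves the ambiguity.\<close>

lemma jump_letter_eq_of_H_word_eq:
  assumes "jump_letter i = jump_letter j"
    and "\<forall>k<n. H_word (Suc i + k) = H_word (Suc j + k)"
  shows "\<forall>k<n. jump_letter (i + k) = jump_letter (j + k)"
proof (intro allI impI)
  fix k assume "k < n"
  then show "jump_letter (i + k) = jump_letter (j + k)"
  proof (induction k)
    case (Suc k)
    have "H_word (Suc i + Suc k) = H_word (Suc j + Suc k)" using assms(2) Suc.prems by blast
    then have "jump_letter (Suc (i + k)) = 3 \<longleftrightarrow> jump_letter (Suc (j + k)) = 3"
      by (simp add: H_word_Suc split: if_splits)
    then show ?case
      using Suc pred_of_1[of "i + k"] pred_of_1[of "j + k"] pred_of_2[of "i + k"] pred_of_2[of "j + k"]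
        jump_letter_cases[of "Suc (i + k)"] jump_letter_cases[of "Suc (j + k)"] by auto
  qed (use assms(1) in simp)
qed

lemma H_word_left_special_imp:
  assumes i: "H_word i = 1" and j: "H_word j = 2"
    and agree: "\<forall>k<n. H_word (Suc i + k) = H_word (Suc j + k)"
  shows "(\<forall>k<n. H_word (Suc i + k) = H_word k) \<or> (\<forall>k<n. H_word (Suc i + k) = H_word (Suc k))"
proof (cases "n = 0")
  case False
  then have eq: "H_word (Suc i) = H_word (Suc j)" using agree by force
  obtain j' where j': "j = Suc j'" using j H_word_0 by (cases j) auto
  have j3: "jump_letter j' = 3" using j by (simp add: j' H_word_Suc split: if_splits)
  show ?thesis
  proof (cases i)
    case (Suc i')
    have i3: "jump_letter i' \<noteq> 3" using i by (simp add: Suc H_word_Suc split: if_splits)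
    show ?thesis
    \<comment> \<open>If \<open>3\<close> comes next, decoding yields a prefix of the fixed point,
      hence of \<open>H_word\<close> without its first letter. Otherwise the next letters are
      \<open>2\<close> and \<open>1\<close>, both coded as the initial \<open>1\<close> of
      \<open>H_word\<close>, and a prefix of the fixed point follows.\<close>
    proof (cases "jump_letter i = 3")
      case True
      then have "jump_letter j = 3" using eq by (simp add: H_word_Suc split: if_splits)
      then have "\<forall>k<n. jump_letter (Suc i' + k) = jump_letter (Suc j' + k)"
        using jump_letter_eq_of_H_word_eq[OF _ agree] True unfolding Suc j' by simp
      then have "\<forall>k<n. jump_letter (Suc i' + k) = jump_letter k"
        using left_special_imp_prefix i3 j3 by metis
      then show ?thesis by (simp add: Suc H_word_Suc)
    next
      case False
      then have jn3: "jump_letter j \<noteq> 3" using eq by (simp add: H_word_Suc split: if_splits)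
      then have j1: "jump_letter j = 1"
        using pred_of_2[of j'] jump_letter_cases[of j] j3 by (auto simp: j')
      have i2: "jump_letter i = 2"
        using False i3 pred_of_1[of i'] jump_letter_cases[of i] by (auto simp: Suc)
      have si3: "jump_letter (Suc i) = 3" using i2 succ_of_2 by simp
      have agree': "\<forall>k<n - 1. H_word (Suc (Suc i) + k) = H_word (Suc (Suc j) + k)"
        using agree by (metis add_Suc_shift less_diff_conv Suc_eq_plus1)
      have "\<forall>k<n - 1. jump_letter (Suc i + k) = jump_letter (Suc j + k)"
      proof (cases "n = 1")
        case False
        then have "H_word (Suc (Suc i)) = H_word (Suc (Suc j))" using agree' \<open>n \<noteq> 0\<close> by force
        then have "jump_letter (Suc j) = 3" using si3 by (simp add: H_word_Suc split: if_splits)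
        then show ?thesis using jump_letter_eq_of_H_word_eq[OF _ agree'] si3 by simp
      qed simp
      then have pre: "\<forall>k<n - 1. jump_letter (Suc i + k) = jump_letter k"
        using left_special_imp_prefix i2 j1 by (metis numeral_eq_one_iff semiring_norm(85))
      have "H_word (Suc i + k) = H_word k" if "k < n" for k
        using that pre i2 by (cases k) (auto simp: H_word_Suc H_word_0)
      then show ?thesis by blast
    qed
  qed simp
qed simp

lemma H_word_prefix_left_extensions:
  assumes "c \<in> {1, 2}"
  shows "\<exists>i. H_word i = c \<and> (\<forall>k<n. H_word (Suc i + k) = H_word k)"
proof -
  \<comment> \<open>The letter \<open>3 - c\<close> is coded as \<open>1 = H_word 0\<close>, and its
    forced predecessor is coded as \<open>c\<close>.\<close>
  obtain i where i: "jump_letter i = 3 - c" "\<forall>k<n. jump_letter (Suc i + k) = jump_letter k"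
    using prefix_left_extensions[of "3 - c" n] assms by auto
  then obtain i' where i': "i = Suc i'" using assms jump_letter_0 by (cases i) auto
  have "jump_letter i' = (if c = 2 then 3 else 1)"
    using i(1) assms pred_of_1[of i'] pred_of_2[of i'] by (auto simp: i')
  then have "H_word i = c" using assms by (auto simp: i' H_word_Suc)
  moreover have "H_word (Suc i + k) = H_word k" if "k < n" for k
    using that i assms by (cases k) (auto simp: H_word_Suc H_word_0)
  ultimately show ?thesis by blast
qed

lemma H_word_tail_prefix_left_extensions:
  assumes "c \<in> {1, 2}"
  shows "\<exists>i. H_word i = c \<and> (\<forall>k<n. H_word (Suc i + k) = H_word (Suc k))"
proof (cases "c = 1")
  case True
  then show ?thesis using H_word_0 by (intro exI[of _ 0]) simp
next
  case False
  then have c: "c = 2" using assms by simp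
  obtain i where "jump_letter i = 3" "\<forall>k<n. jump_letter (Suc i + k) = jump_letter k"
    using prefix_left_extensions[of 3 n] by auto
  then show ?thesis using c by (intro exI[of _ "Suc i"]) (simp add: H_word_Suc)
qed

section \<open>Counting factors\<close>

lemma subsequence_Suc_left: "w [i \<rightarrow> i + Suc n] = w i # w [Suc i \<rightarrow> Suc i + n]"
  by (simp add: subsequence_def upt_conv_Cons del: upt_Suc)

lemma subsequence_eq_iff: "w [i \<rightarrow> i + n] = w [j \<rightarrow> j + n] \<longleftrightarrow> (\<forall>k<n. w (i + k) = w (j + k))"
  by (auto simp: list_eq_iff_nth_eq subsequence_def)

lemma Cons_in_factors_iff:
  "c # u \<in> factors (Suc n) w \<longleftrightarrow> (\<exists>i. w i = c \<and> u = w [Suc i \<rightarrow> Suc i + n])"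
  unfolding factors_def subsequence_Suc_left by auto

lemma finite_factors:
  assumes "finite (range w)"
  shows "finite (factors n w)"
proof (rule finite_subset)
  show "factors n w \<subseteq> {u. set u \<subseteq> range w \<and> length u = n}"
    by (auto simp: factors_def subsequence_def)
qed (use finite_lists_length_eq[OF assms] in simp)

text \<open>Sort the longer factors by first letter and apply inclusion-exclusion to the sets of
  their tails. The hypothesis \<open>prefix\<close> ensures that the factor at position 0 also has a
  left extension.\<close>

lemma card_factors_Suc:
  assumes range: "range w \<subseteq> {a, b}" and "a \<noteq> b"
    and prefix: "c # w [0 \<rightarrow> n] \<in> factors (Suc n) w"
  shows "card (factors (Suc n) w) =
    card (factors n w) + card {u. a # u \<in> factors (Suc n) w \<and> b # u \<in> factors (Suc n) w}"
proof -
  let ?E = "\<lambda>c. {u. c # u \<in> factors (Suc n) w}"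
  have fin: "finite (factors m w)" for m
    using finite_factors finite_subset[OF range] by blast
  have sub: "?E c \<subseteq> factors n w" for c
    unfolding Cons_in_factors_iff unfolding factors_def by blast
  then have finE: "finite (?E c)" for c using fin finite_subset by blast
  have ab: "w i = a \<or> w i = b" for i using range by auto
  have "u \<in> ?E a \<union> ?E b" if u: "u \<in> factors n w" for u
  proof -
    obtain i where i: "u = w [i \<rightarrow> i + n]" using u by (auto simp: factors_def)
    obtain i where i: "u = w [Suc i \<rightarrow> Suc i + n]"
    proof (cases i)
      case 0
      then show ?thesis using that prefix i by (auto simp: Cons_in_factors_iff)
    qed (use that i in blast)
    then show ?thesis using ab[of i] by (auto simp: Cons_in_factors_iff)
  qed
  then have un: "factors n w = ?E a \<union> ?E b" using sub by blast
  have split: "factors (Suc n) w = (#) a ` ?E a \<union> (#) b ` ?E b"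
  proof (intro equalityI subsetI)
    fix v assume v: "v \<in> factors (Suc n) w"
    then obtain i where "v = w i # w [Suc i \<rightarrow> Suc i + n]"
      unfolding factors_def subsequence_Suc_left by auto
    then show "v \<in> (#) a ` ?E a \<union> (#) b ` ?E b" using v ab[of i] by auto
  qed auto
  have "card (factors (Suc n) w) = card ((#) a ` ?E a) + card ((#) b ` ?E b)"
    by (subst split, rule card_Un_disjoint) (use finE \<open>a \<noteq> b\<close> in auto)
  also have "\<dots> = card (?E a) + card (?E b)" by (simp add: card_image)
  also have "\<dots> = card (?E a \<union> ?E b) + card (?E a \<inter> ?E b)"
    using card_Un_Int finE by blast
  also have "?E a \<inter> ?E b = {u. a # u \<in> factors (Suc n) w \<and> b # u \<in> factors (Suc n) w}" by auto
  finally show ?thesis using un by simp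
qed

lemma H_word_left_special:
  "{u. 1 # u \<in> factors (Suc n) H_word \<and> 2 # u \<in> factors (Suc n) H_word} =
    {H_word [0 \<rightarrow> n], H_word [1 \<rightarrow> Suc n]}" (is "?L = ?R")
proof (intro equalityI subsetI)
  fix u assume "u \<in> ?L"
  then obtain i j where i: "H_word i = 1" "u = H_word [Suc i \<rightarrow> Suc i + n]"
    and j: "H_word j = 2" "u = H_word [Suc j \<rightarrow> Suc j + n]"
    by (auto simp: Cons_in_factors_iff)
  have "\<forall>k<n. H_word (Suc i + k) = H_word (Suc j + k)"
    using i(2) j(2) subsequence_eq_iff by metis
  from H_word_left_special_imp[OF i(1) j(1) this] show "u \<in> ?R"
    using subsequence_eq_iff[of H_word "Suc i" n 0] subsequence_eq_iff[of H_word "Suc i" n 1] i(2)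
    by auto
next
  fix u assume u: "u \<in> ?R"
  have "c # u \<in> factors (Suc n) H_word" if c: "c \<in> {1, 2}" for c
  proof -
    have "\<exists>i. H_word i = c \<and> H_word [Suc i \<rightarrow> Suc i + n] = H_word [0 \<rightarrow> 0 + n]"
      using H_word_prefix_left_extensions[OF c, of n] unfolding subsequence_eq_iff by simp
    moreover have "\<exists>i. H_word i = c \<and> H_word [Suc i \<rightarrow> Suc i + n] = H_word [1 \<rightarrow> 1 + n]"
      using H_word_tail_prefix_left_extensions[OF c, of n] unfolding subsequence_eq_iff by simp
    ultimately show ?thesis using u unfolding Cons_in_factors_iff by fastforce
  qed
  then show "u \<in> ?L" by simp
qed

lemma card_factors_H_word_Suc:
  "card (factors (Suc n) H_word) =
    card (factors n H_word) + card {H_word [0 \<rightarrow> n], H_word [1 \<rightarrow> Suc n]}"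
proof -
  have "range H_word \<subseteq> {1, 2}"
  proof (intro subsetI, elim rangeE)
    fix x i assume "x = H_word i"
    then show "x \<in> {1, 2}" by (cases i) (auto simp: H_word_0 H_word_Suc)
  qed
  moreover have "1 # H_word [0 \<rightarrow> n] \<in> factors (Suc n) H_word"
    using H_word_left_special[of n] by blast
  ultimately show ?thesis
    using card_factors_Suc[of H_word 1 2 1 n] H_word_left_special[of n] by simp
qed

theorem theorem40:
  fixes n :: nat
  assumes "n \<ge> 1"
  shows "card (factors n H_word) = 2 * n"
  using assms
proof (induction n rule: dec_induct)
  case base
  have "factors 0 H_word = {[]}" by (auto simp: factors_def)
  \<comment> \<open>For length 0 the two left special words coincide, so the count rises only from
    one to two.\<close>
  then show ?case using card_factors_H_word_Suc[of 0] by simp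
next
  case (step n)
  \<comment> \<open>For positive length the two left special words already differ in their first
    letter.\<close>
  have "H_word 0 \<noteq> H_word 1" using H_word_Suc[of 0] by (simp add: H_word_0 jump_letter_0)
  then have "H_word [0 \<rightarrow> n] \<noteq> H_word [1 \<rightarrow> Suc n]"
    using subsequence_eq_iff[of H_word 0 n 1] spec[of _ 0] step.hyps(1) by (auto simp: less_eq_Suc_le)
  then show ?case using step card_factors_H_word_Suc[of n] by simp
qed

end
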